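(* Let $G$ and $H$ be two finite groups, written additively, and let $F\colon G\to H$ be a perfect nonlinear function. If $|H|\le\sqrt{|G|}$, then $F$ is surjective. Moreover, under this hypothesis, a preimage set of size $1$ (i.e. $|F^{-1}(\beta)|=1$ for some $\beta\in H$) is only possible if $|H|=\sqrt{|G|}$.
   Context: A function $F\colon G\to H$ between finite groups is perfect nonlinear if $|\{x\in G: F(x+a)-F(x)=b\}|=|G|/|H|$ for all $a\in G\setminus\{0\}$ and all $b\in H$. $F^{-1}(\beta)$ denotes the preimage set of $\beta$. *)

theory Defs
  imports Complex_Main "HOL-Algebra.Coset"
begin

text \<open>The groups need not be commutative, so they are multiplicative groups of HOL-Algebra:
  in additive notation the condition on \<open>x\<close> below is \<open>F (x + a) - F x = b\<close>, and
  \<open>F (x + a) - F x\<close> means \<open>F (x + a) + (- F x)\<close>.\<close>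

definition perfect_nonlinear ::
  "('a, 'c) monoid_scheme \<Rightarrow> ('b, 'd) monoid_scheme \<Rightarrow> ('a \<Rightarrow> 'b) \<Rightarrow> bool" where
  "perfect_nonlinear G H F \<longleftrightarrow>
     F \<in> carrier G \<rightarrow> carrier H \<and>
     (\<forall>a \<in> carrier G - {\<one>\<^bsub>G\<^esub>}. \<forall>b \<in> carrier H.
        real (card {x \<in> carrier G. F (x \<otimes>\<^bsub>G\<^esub> a) \<otimes>\<^bsub>H\<^esub> inv\<^bsub>H\<^esub> (F x) = b})
          = real (order G) / real (order H))"

end

theory Submission
  imports Defs "HOL-Analysis.Convex"
begin

text \<open>Write \<open>N = |G|\<close>, \<open>m = |H|\<close> and let \<open>k \<beta>\<close> be the size of the fibre over \<open>\<beta>\<close>. Perfect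
  nonlinearity with \<open>b = 0\<close> gives the second moment \<open>m \<Sum> (k \<beta>)\<^sup>2 = m N + N (N - 1)\<close>.
  By Cauchy--Schwarz over \<open>H - {\<beta>}\<close>, \<open>(N - k \<beta>)\<^sup>2 \<le> (m - 1) (\<Sum> (k \<gamma>)\<^sup>2 - (k \<beta>)\<^sup>2)\<close>.
  For \<open>k \<beta> = 0\<close> this says \<open>N \<le> (m - 1)\<^sup>2\<close>, and for \<open>k \<beta> = 1\<close> it says
  \<open>(N - 1) (N - m\<^sup>2) \<le> 0\<close>.\<close>

text \<open>Both sides count the pairs \<open>(x, y)\<close> in \<open>A\<close> with
  \<open>F x = F y\<close>: the left groups them by their common value, the right by
  \<open>x\<close>.\<close>

lemma sum_card_fibre_squares:
  assumes "finite A" "finite B" "F \<in> A \<rightarrow> B"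
  shows "(\<Sum>\<beta>\<in>B. (card {x \<in> A. F x = \<beta>})\<^sup>2) = (\<Sum>x\<in>A. card {y \<in> A. F y = F x})"
proof -
  have "(\<Sum>x\<in>A. card {y \<in> A. F y = F x}) =
      (\<Sum>\<beta>\<in>B. \<Sum>x | x \<in> A \<and> F x = \<beta>. card {y \<in> A. F y = F x})"
    using assms by (intro sum.group [symmetric]) auto
  also have "\<dots> = (\<Sum>\<beta>\<in>B. (card {x \<in> A. F x = \<beta>})\<^sup>2)"
    by (intro sum.cong) (simp_all add: power2_eq_square)
  finally show ?thesis by simp
qed

lemma sum_card_fibre:
  assumes "finite A" "finite B" "F \<in> A \<rightarrow> B"
  shows "(\<Sum>\<beta>\<in>B. card {x \<in> A. F x = \<beta>}) = card A"
  using sum.group [of A B F "\<lambda>_. 1::nat"] assms by (auto simp: image_subset_iff)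

text \<open>For fixed \<open>x\<close>, the map sending \<open>a\<close> to
  \<open>x \<otimes> a\<close> permutes the group. So counting pairs \<open>(x, a)\<close> by
  differences, as perfect nonlinearity does, amounts to counting colliding pairs
  \<open>(x, y)\<close> with \<open>y = x \<otimes> a\<close>.\<close>

lemma (in group) sum_card_translate_eq:
  assumes "finite (carrier G)"
  shows "(\<Sum>a\<in>carrier G. card {x \<in> carrier G. F (x \<otimes> a) = F x}) =
         (\<Sum>x\<in>carrier G. card {y \<in> carrier G. F y = F x})"
proof -
  have "(\<Sum>a\<in>carrier G. card {x \<in> carrier G. F (x \<otimes> a) = F x}) =
      (\<Sum>a\<in>carrier G. \<Sum>x\<in>carrier G. of_bool (F (x \<otimes> a) = F x))"
    using assms by (simp add: Int_def)
  also have "\<dots> = (\<Sum>x\<in>carrier G. \<Sum>a\<in>carrier G. of_bool (F (x \<otimes> a) = F x))"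
    by (rule sum.swap)
  also have "\<dots> = (\<Sum>x\<in>carrier G. \<Sum>y\<in>carrier G. of_bool (F y = F x))"
  proof (rule sum.cong [OF refl])
    fix x assume x: "x \<in> carrier G"
    have "bij_betw ((\<otimes>) x) (carrier G) (carrier G)"
      using x by (simp add: bij_betw_def inj_on_cmult surj_const_mult)
    then show "(\<Sum>a\<in>carrier G. of_bool (F (x \<otimes> a) = F x)) =
        (\<Sum>y\<in>carrier G. of_bool (F y = F x) :: nat)"
      by (rule sum.reindex_bij_betw)
  qed
  also have "\<dots> = (\<Sum>x\<in>carrier G. card {y \<in> carrier G. F y = F x})"
    using assms by (simp add: Int_def)
  finally show ?thesis .
qed

text \<open>The sum of squares counts colliding pairs, here sorted by the translation
  \<open>a\<close> that joins them. Multiplying by \<open>order H\<close> clears the denominator of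
  \<open>order G / order H\<close>.\<close>

lemma perfect_nonlinear_fibre_squares:
  fixes G :: "('a, 'c) monoid_scheme" and H :: "('b, 'd) monoid_scheme"
  assumes "group G" "finite (carrier G)" "group H" "finite (carrier H)"
    and pn: "perfect_nonlinear G H F"
  shows "real (order H) * (\<Sum>\<beta>\<in>carrier H. (real (card {x \<in> carrier G. F x = \<beta>}))\<^sup>2) =
         real (order H) * real (order G) + real (order G) * (real (order G) - 1)"
proof -
  interpret G: group G by fact
  interpret H: group H by fact
  let ?N = "real (order G)" and ?m = "real (order H)"
  have F: "F \<in> carrier G \<rightarrow> carrier H"
    using pn by (simp add: perfect_nonlinear_def)
  have m: "?m > 0"
    using H.order_gt_0_iff_finite assms(4) by simp
  have N: "order G \<ge> 1"
    using G.order_gt_0_iff_finite assms(2) by simp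
  \<comment> \<open>This is perfect nonlinearity at the neutral element of \<open>H\<close>: a
    trivial difference means equal values.\<close>
  have count: "real (card {x \<in> carrier G. F (x \<otimes>\<^bsub>G\<^esub> a) = F x}) = ?N / ?m"
    if "a \<in> carrier G - {\<one>\<^bsub>G\<^esub>}" for a
  proof -
    have "F (x \<otimes>\<^bsub>G\<^esub> a) \<otimes>\<^bsub>H\<^esub> inv\<^bsub>H\<^esub> F x = \<one>\<^bsub>H\<^esub> \<longleftrightarrow> F (x \<otimes>\<^bsub>G\<^esub> a) = F x"
      if "x \<in> carrier G" for x
    proof -
      have "F (x \<otimes>\<^bsub>G\<^esub> a) \<in> carrier H" "F x \<in> carrier H"
        using F that \<open>a \<in> carrier G - {\<one>\<^bsub>G\<^esub>}\<close> by auto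
      then show ?thesis
        by (metis H.inv_equality H.inv_inv H.inv_closed H.r_inv)
    qed
    then have "{x \<in> carrier G. F (x \<otimes>\<^bsub>G\<^esub> a) = F x} =
        {x \<in> carrier G. F (x \<otimes>\<^bsub>G\<^esub> a) \<otimes>\<^bsub>H\<^esub> inv\<^bsub>H\<^esub> (F x) = \<one>\<^bsub>H\<^esub>}"
      by blast
    then show ?thesis
      using pn that by (simp add: perfect_nonlinear_def)
  qed
  have "(\<Sum>\<beta>\<in>carrier H. (real (card {x \<in> carrier G. F x = \<beta>}))\<^sup>2) =
      real (\<Sum>\<beta>\<in>carrier H. (card {x \<in> carrier G. F x = \<beta>})\<^sup>2)"
    by simp
  also have "\<dots> = real (\<Sum>a\<in>carrier G. card {x \<in> carrier G. F (x \<otimes>\<^bsub>G\<^esub> a) = F x})"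
    by (simp only: sum_card_fibre_squares [OF assms(2,4) F] G.sum_card_translate_eq [OF assms(2)])
  also have "\<dots> = (\<Sum>a\<in>carrier G. real (card {x \<in> carrier G. F (x \<otimes>\<^bsub>G\<^esub> a) = F x}))"
    by simp
  \<comment> \<open>The translation by the neutral element, excluded from perfect nonlinearity,
    fixes every \<open>x\<close> and so contributes all of \<open>?N\<close>.\<close>
  also have "\<dots> = ?N + (\<Sum>a\<in>carrier G - {\<one>\<^bsub>G\<^esub>}. real (card {x \<in> carrier G. F (x \<otimes>\<^bsub>G\<^esub> a) = F x}))"
    using assms(2) by (subst sum.remove [of _ "\<one>\<^bsub>G\<^esub>"]) (auto simp: order_def cong: conj_cong)
  also have "\<dots> = ?N + (?N - 1) * (?N / ?m)"
    using assms(2) N by (simp add: count order_def of_nat_diff)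
  finally show ?thesis
    using m by (simp add: field_simps)
qed

text \<open>Cauchy-Schwarz applies to the \<open>m - 1\<close> fibres other than that of
  \<open>\<beta>\<close>, which together hold \<open>N - c\<close> elements. Keeping
  \<open>c\<close> general lets one inequality serve both an empty fibre and a singleton.\<close>

lemma perfect_nonlinear_fibre_bound:
  fixes G :: "('a, 'c) monoid_scheme" and H :: "('b, 'd) monoid_scheme"
  assumes "group G" "finite (carrier G)" "group H" "finite (carrier H)"
    and "perfect_nonlinear G H F" and \<beta>: "\<beta> \<in> carrier H"
  defines "N \<equiv> real (order G)" and "m \<equiv> real (order H)"
    and "c \<equiv> real (card {x \<in> carrier G. F x = \<beta>})"
  shows "m * (N - c)\<^sup>2 \<le> (m - 1) * (m * N + N * (N - 1) - m * c\<^sup>2)"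
proof -
  define k where "k \<gamma> = real (card {x \<in> carrier G. F x = \<gamma>})" for \<gamma>
  interpret H: group H by fact
  have m: "order H \<ge> 1"
    using H.order_gt_0_iff_finite assms(4) by simp
  have F: "F \<in> carrier G \<rightarrow> carrier H"
    using assms(5) by (simp add: perfect_nonlinear_def)
  have "real (\<Sum>\<beta>\<in>carrier H. card {x \<in> carrier G. F x = \<beta>}) = N"
    unfolding N_def order_def by (simp only: sum_card_fibre [OF assms(2,4) F])
  then have s1: "(\<Sum>\<gamma>\<in>carrier H - {\<beta>}. k \<gamma>) = N - c"
    using assms(4) \<beta> by (simp add: k_def c_def sum_diff1)
  have s2: "m * (\<Sum>\<gamma>\<in>carrier H - {\<beta>}. (k \<gamma>)\<^sup>2) = m * N + N * (N - 1) - m * c\<^sup>2"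
    using perfect_nonlinear_fibre_squares [OF assms(1-5)] assms(4) \<beta>
    by (simp add: k_def c_def m_def N_def sum_diff1 right_diff_distrib)
  have "real (card (carrier H - {\<beta>})) = m - 1"
    using assms(4) \<beta> m by (simp add: m_def order_def of_nat_diff)
  then have "(N - c)\<^sup>2 \<le> (\<Sum>\<gamma>\<in>carrier H - {\<beta>}. (k \<gamma>)\<^sup>2) * (m - 1)"
    using sum_squared_le_sum_of_squares [of k "carrier H - {\<beta>}"] by (simp add: s1)
  then have "m * (N - c)\<^sup>2 \<le> m * ((\<Sum>\<gamma>\<in>carrier H - {\<beta>}. (k \<gamma>)\<^sup>2) * (m - 1))"
    by (intro mult_left_mono) (simp_all add: m_def)
  then show ?thesis
    unfolding s2 [symmetric] by (simp only: mult_ac)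
qed

theorem corollary2p7:
  fixes G :: "('a, 'c) monoid_scheme" and H :: "('b, 'd) monoid_scheme" and F :: "'a \<Rightarrow> 'b"
  assumes "group G" and "finite (carrier G)"
    and "group H" and "finite (carrier H)"
    and "perfect_nonlinear G H F"
    and "real (order H) \<le> sqrt (real (order G))"
  shows "F ` carrier G = carrier H \<and>
    (\<forall>\<beta> \<in> carrier H. card (F -` {\<beta>} \<inter> carrier G) = 1 \<longrightarrow>
       real (order H) = sqrt (real (order G)))"
proof -
  define N where "N = real (order G)"
  define m where "m = real (order H)"
  interpret G: group G by fact
  interpret H: group H by fact
  have m: "m \<ge> 1"
    using H.order_gt_0_iff_finite assms(4) unfolding m_def by simp
  have N: "N \<ge> 1"
    using G.order_gt_0_iff_finite assms(2) unfolding N_def by simp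
  have "m\<^sup>2 \<le> (sqrt N)\<^sup>2"
    using assms(6) m by (intro power_mono) (simp_all add: m_def N_def)
  then have mN: "m\<^sup>2 \<le> N"
    using N by simp
  note bound = perfect_nonlinear_fibre_bound [OF assms(1-5), folded N_def m_def]
  have "\<beta> \<in> F ` carrier G" if \<beta>: "\<beta> \<in> carrier H" for \<beta>
  proof (rule ccontr)
    assume "\<beta> \<notin> F ` carrier G"
    then have "card {x \<in> carrier G. F x = \<beta>} = 0"
      by (metis (mono_tags, lifting) card.empty empty_Collect_eq image_eqI)
    then have "m * N\<^sup>2 \<le> (m - 1) * (m * N + N * (N - 1))"
      using bound [OF \<beta>] by (simp del: card_eq_0_iff)
    then have "N * N \<le> N * (m - 1)\<^sup>2"
      by (simp add: power2_eq_square algebra_simps)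
    then have "N \<le> (m - 1)\<^sup>2"
      using N by simp
    \<comment> \<open>Now \<open>m\<^sup>2 \<le> (m - 1)\<^sup>2\<close>, that is
      \<open>2 * m \<le> 1\<close>, against \<open>m \<ge> 1\<close>.\<close>
    then show False
      using mN m by (simp add: power2_eq_square algebra_simps)
  qed
  moreover have "F ` carrier G \<subseteq> carrier H"
    using assms(5) by (auto simp: perfect_nonlinear_def)
  moreover have "m = sqrt N" if \<beta>: "\<beta> \<in> carrier H" and "card (F -` {\<beta>} \<inter> carrier G) = 1" for \<beta>
  proof -
    have "F -` {\<beta>} \<inter> carrier G = {x \<in> carrier G. F x = \<beta>}"
      by blast
    then have "m * (N - 1)\<^sup>2 \<le> (m - 1) * (m * N + N * (N - 1) - m)"
      using bound [OF \<beta>] that(2) by simp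
    \<comment> \<open>The last factor on the right is
      \<open>m * N + N * (N - 1) - m = (N - 1) * (N + m)\<close>, so \<open>N - 1\<close> splits off
      both sides.\<close>
    then have "(N - 1) * (N - m\<^sup>2) \<le> 0"
      by (simp add: power2_eq_square algebra_simps)
    \<comment> \<open>The factor \<open>N - 1\<close> may vanish. In that case
      \<open>1 \<le> m\<^sup>2 \<le> N = 1\<close> still gives \<open>N = m\<^sup>2\<close>.\<close>
    then have "N = 1 \<or> N \<le> m\<^sup>2"
      using N by (auto simp: mult_le_0_iff)
    moreover have "1 \<le> m\<^sup>2"
      using m by simp
    ultimately have "N = m\<^sup>2"
      using mN by linarith
    then show ?thesis
      using m by simp
  qed
  ultimately show ?thesis
    unfolding m_def N_def by blast
qed

end
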